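(* Let $N,s$ be integers with $0\le s\le N$, and let $\{\nu_j\}_{j=1}^{[(N-s)/2]}$ be the set of positive zeros of $U_N^{(s)}$, the $s$-th derivative of the Chebyshev polynomial of the second kind $U_N$. Then, as an identity of polynomials in $z$, $$\sum_{j=0}^{s}(-1)^j\binom{s}{j}\binom{N+s+1}{j}\binom{N}{j}^{-1}\left(z^j-z^{N+s+1-j}\right)=(1-z)^{2s+1}\,\epsilon(z)\prod_{j=1}^{[(N-s)/2]}\left[z^2+1+2z\left(1-2\nu_j^2\right)\right],$$ where $\epsilon(z)=1+z$ if $N-s$ is odd and $\epsilon(z)=1$ if $N-s$ is even.
   Context: $[x]$ denotes the integer part of $x$, and an empty product equals $1$. The Chebyshev polynomial of the second kind is $U_N(z)=\sum_{j=0}^{[N/2]}(-1)^j\binom{N-j}{j}(2z)^{N-2j}$ for integers $N\ge 0$. For $0\le s\le N$, the polynomial $U_N^{(s)}$ has exactly $[(N-s)/2]$ distinct positive zeros. *)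

theory Defs
  imports Complex_Main "HOL-Computational_Algebra.Polynomial"
begin

text \<open>The base polynomial \<open>[:0, 2:]\<close> is \<open>2z\<close>.\<close>
definition cheb_U :: "nat \<Rightarrow> real poly" where
  "cheb_U N = (\<Sum>j = 0..N div 2.
     smult ((-1) ^ j * real ((N - j) choose j)) ([:0, 2:] ^ (N - 2 * j)))"

definition cheb_U_deriv :: "nat \<Rightarrow> nat \<Rightarrow> real poly" where
  "cheb_U_deriv s N = (pderiv ^^ s) (cheb_U N)"

text \<open>For \<open>s \<le> N\<close> this set is finite, as \<^term>\<open>cheb_U_deriv s N\<close> then has degree \<open>N - s\<close>.\<close>
definition pos_zeros_U :: "nat \<Rightarrow> nat \<Rightarrow> real set" where
  "pos_zeros_U s N = {x. 0 < x \<and> poly (cheb_U_deriv s N) x = 0}"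

end

theory Submission
  imports Defs
begin

text \<open>
  The substitution \<open>x = (w + 1/w)/2\<close>, \<open>z = w\<^sup>2\<close> explains both sides at once. A factor
  \<open>z\<^sup>2 + 1 + 2z(1 - 2\<nu>\<^sup>2)\<close> equals \<open>4w\<^sup>2(x\<^sup>2 - \<nu>\<^sup>2)\<close>, and \<open>1 + z = 2wx\<close>. So the product on the
  right, together with \<open>\<epsilon>(z)\<close>, is \<open>U\<^sub>N\<^sup>(\<^sup>s\<^sup>)(x) w\<^sup>N\<^sup>-\<^sup>s\<close> up to a constant, as soon as
  \<open>U\<^sub>N\<^sup>(\<^sup>s\<^sup>)\<close> is known to split into the simple linear factors belonging to its positive zeros, their
  negatives and, for odd \<open>N - s\<close>, to 0.

  This splitting (\<open>symmetric_poly_factorization\<close>) needs the zeros of \<open>U\<^sub>N\<^sup>(\<^sup>s\<^sup>)\<close> to be real and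
  simple. For \<open>U\<^sub>N\<close> they are \<open>cos (k\<pi>/(N+1))\<close>, because \<open>U\<^sub>N(cos t) sin t = sin ((N+1)t)\<close>;
  Rolle's theorem hands the property down to every derivative (\<open>card_roots_pderiv\<close>). Parity
  makes the set of zeros symmetric.

  The left-hand side, called \<open>P\<^sub>s(z)\<close> here, comes from the same function. The classical formula
  \<open>U\<^sub>N(x) w\<^sup>N (1 - w\<^sup>2) = 1 - w\<^sup>2\<^sup>N\<^sup>+\<^sup>2\<close> is the case \<open>s = 0\<close> of
  \<open>U\<^sub>N\<^sup>(\<^sup>s\<^sup>)(x) w\<^sup>N\<^sup>-\<^sup>s (1 - w\<^sup>2)\<^sup>2\<^sup>s\<^sup>+\<^sup>1 = 2\<^sup>s N!/(N-s)! P\<^sub>s(w\<^sup>2)\<close>,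
  and differentiating this identity in \<open>w\<close> carries it from \<open>s\<close> to \<open>s + 1\<close> precisely when
  \<open>(N-s) P\<^sub>s\<^sub>+\<^sub>1 = ((N-s) - (N+3s+2)z) P\<^sub>s - 2z(1-z) P\<^sub>s'\<close>. The explicit coefficients of \<open>P\<^sub>s\<close>
  satisfy this recurrence (\<open>deriv_numer_Suc\<close>).

  Both sides of the theorem are therefore proportional for all \<open>z > 0\<close>, hence as polynomials;
  both have the value 1 at 0, so they are equal.
\<close>

section \<open>The recurrence for Chebyshev polynomials\<close>

lemma cheb_U_0: "cheb_U 0 = 1" and cheb_U_1: "cheb_U (Suc 0) = [:0, 2:]"
  by (simp_all add: cheb_U_def)

text \<open>
  The binomial coefficient vanishes beyond \<open>N div 2\<close>. A summation bound that does not depend on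
  the parity of \<open>N\<close> lets three consecutive polynomials be compared term by term.
\<close>
lemma cheb_U_conv_full_sum:
  assumes "N div 2 \<le> m"
  shows "cheb_U N = (\<Sum>j\<le>m. smult ((-1) ^ j * real ((N - j) choose j)) ([:0, 2:] ^ (N - 2 * j)))"
  unfolding cheb_U_def using assms
  by (intro sum.mono_neutral_left) (auto simp: binomial_eq_0)

text \<open>
  Pascal's rule, applied to the term of index \<open>j + 1\<close>, gives a term of index \<open>j + 1\<close> for
  \<open>N + 1\<close> and one of index \<open>j\<close> for \<open>N\<close>.
\<close>
lemma cheb_U_rec: "cheb_U (Suc (Suc N)) = [:0, 2:] * cheb_U (Suc N) - cheb_U N"
proof -
  let ?t = "\<lambda>n j. smult ((-1) ^ j * real ((n - j) choose j)) ([:0, 2:] ^ (n - 2 * j)) :: real poly"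
  have step: "?t (Suc (Suc N)) (Suc j) = [:0, 2:] * ?t (Suc N) (Suc j) - ?t N j" if "j \<le> N" for j
  proof (cases "2 * j < N")
    case True
    then have "Suc N - 2 * j = Suc (Suc (N - 2 * j - 1))" "N - 2 * j = Suc (N - 2 * j - 1)"
       "Suc N - 2 * Suc j = N - 2 * j - 1" "Suc N - j = Suc (N - j)"
      by auto
    then show ?thesis
      by (intro poly_ext) (simp add: algebra_simps)
  next
    \<comment> \<open>The exponent in the term for \<open>N + 1\<close> is truncated at 0 here, but its coefficient is 0.\<close>
    case False
    then have "(N - j) choose Suc j = 0" by (simp add: binomial_eq_0)
    then show ?thesis using that
      by (intro poly_ext) (simp add: Suc_diff_le algebra_simps)
  qed
  have "cheb_U (Suc (Suc N)) = (\<Sum>j\<le>Suc N. ?t (Suc (Suc N)) j)"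
    by (rule cheb_U_conv_full_sum) auto
  also have "\<dots> = ?t (Suc (Suc N)) 0 + (\<Sum>j\<le>N. ?t (Suc (Suc N)) (Suc j))"
    by (rule sum.atMost_Suc_shift)
  also have "\<dots> = [:0, 2:] * ?t (Suc N) 0 + (\<Sum>j\<le>N. [:0, 2:] * ?t (Suc N) (Suc j) - ?t N j)"
    using step by (intro arg_cong2[of _ _ _ _ "(+)"] sum.cong) (auto simp del: mult_pCons_left)
  also have "\<dots> = [:0, 2:] * (?t (Suc N) 0 + (\<Sum>j\<le>N. ?t (Suc N) (Suc j))) - (\<Sum>j\<le>N. ?t N j)"
    by (simp only: sum_subtractf sum_distrib_left distrib_left add_diff_eq)
  also have "?t (Suc N) 0 + (\<Sum>j\<le>N. ?t (Suc N) (Suc j)) = (\<Sum>j\<le>Suc N. ?t (Suc N) j)"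
    by (rule sum.atMost_Suc_shift[symmetric])
  also have "\<dots> = cheb_U (Suc N)" by (rule cheb_U_conv_full_sum[symmetric]) auto
  also have "(\<Sum>j\<le>N. ?t N j) = cheb_U N" by (rule cheb_U_conv_full_sum[symmetric]) auto
  finally show ?thesis .
qed

lemma cheb_U_deriv_Suc: "cheb_U_deriv (Suc s) N = pderiv (cheb_U_deriv s N)"
  by (simp add: cheb_U_deriv_def)

section \<open>The left-hand polynomials and their recurrence in the order of differentiation\<close>

definition deriv_numer_coeff :: "nat \<Rightarrow> nat \<Rightarrow> nat \<Rightarrow> real" where
  "deriv_numer_coeff N s j =
     (-1) ^ j * real (s choose j) * real ((N + s + 1) choose j) * inverse (real (N choose j))"

text \<open>
  For \<open>j \<le> M\<close>, reversing the coefficients in degree \<open>M\<close> changes the sign of this polynomial.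
\<close>
definition antipal_binomial :: "nat \<Rightarrow> nat \<Rightarrow> real poly" where
  "antipal_binomial M j = monom 1 j - monom 1 (M - j)"

text \<open>
  Up to a constant, this is the numerator of the \<open>s\<close>-th derivative of \<open>U\<^sub>N\<close> at
  \<open>(w + 1/w)/2\<close>, written as a polynomial in \<open>w\<^sup>2\<close>.
\<close>
definition deriv_numer :: "nat \<Rightarrow> nat \<Rightarrow> real poly" where
  "deriv_numer N s = (\<Sum>j = 0..s. smult (deriv_numer_coeff N s j) (antipal_binomial (N + s + 1) j))"

text \<open>
  The coefficient of index \<open>Suc i\<close> in the recurrence for the polynomials. By absorption, all three
  coefficients are multiples of one quantity \<open>T\<close> by polynomials in \<open>N\<close>, \<open>s\<close>, \<open>i\<close>, so that only
  the identity \<open>(N-s)(s+1)(N+s+2) = (N-s-2i-2)(s-i)(N+s+1-i) + (N+3s+2-2i)(i+1)(N-i)\<close> remains.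
\<close>
lemma deriv_numer_coeff_Suc:
  assumes "s < N" "i \<le> s"
  shows "real (N - s) * deriv_numer_coeff N (Suc s) (Suc i) =
         (real (N - s) - 2 * real (Suc i)) * deriv_numer_coeff N s (Suc i)
         - (real (N + 3 * s + 2) - 2 * real i) * deriv_numer_coeff N s i"
proof -
  have absorb: "real (m choose Suc i) = (real m - real i) / (real i + 1) * real (m choose i)" for m
  proof (cases "i \<le> m")
    case True
    have "Suc i * (m choose Suc i) = (m - i) * (m choose i)"
      by (metis binomial_absorb_comp binomial_absorption)
    then have "real (Suc i) * real (m choose Suc i) = real (m - i) * real (m choose i)"
      by (metis of_nat_mult)
    with True show ?thesis by (simp add: field_simps of_nat_diff)
  qed (simp add: binomial_eq_0)
  have shift: "real (Suc m choose Suc i) = (real m + 1) / (real i + 1) * real (m choose i)" for m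
  proof -
    have "real (Suc i) * real (Suc m choose Suc i) = real (Suc m) * real (m choose i)"
      by (metis Suc_times_binomial of_nat_mult)
    then show ?thesis by (simp add: field_simps)
  qed
  have pos: "real (N choose i) \<noteq> 0" using assms by simp
  have pos': "real N - real i \<noteq> 0" using assms by simp
  have M: "N + Suc s + 1 = Suc (N + s + 1)" by simp
  define T where "T = (-1) ^ i * real (s choose i) * real (N + s + 1 choose i) /
    ((real i + 1) * (real N - real i) * real (N choose i))"
  have 1: "deriv_numer_coeff N (Suc s) (Suc i) = - T * ((real s + 1) * (real N + real s + 2))"
    unfolding deriv_numer_coeff_def M absorb[of N] shift T_def
    using pos pos' by (simp add: divide_simps)
  have 2: "deriv_numer_coeff N s (Suc i) = - T * ((real s - real i) * (real N + real s + 1 - real i))"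
    unfolding deriv_numer_coeff_def absorb T_def
    using pos pos' by (simp add: divide_simps)
  have 3: "deriv_numer_coeff N s i = T * ((real i + 1) * (real N - real i))"
    unfolding deriv_numer_coeff_def T_def using pos pos' by (simp add: divide_simps)
  have 4: "real (N - s) = real N - real s" using assms by simp
  show ?thesis
    unfolding 1 2 3 4 by (simp add: algebra_simps)
qed

text \<open>
  What \<open>d/dw\<close> becomes on numerators: differentiating
  \<open>P(w\<^sup>2) w\<^sup>-\<^sup>(\<^sup>N\<^sup>-\<^sup>s\<^sup>) (1 - w\<^sup>2)\<^sup>-\<^sup>(\<^sup>2\<^sup>s\<^sup>+\<^sup>1\<^sup>)\<close> and dividing by \<open>dx/dw\<close> leads, apart from a
  factor 2 and the new denominators, to this expression at \<open>z = w\<^sup>2\<close>.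
\<close>
definition deriv_numer_step :: "nat \<Rightarrow> nat \<Rightarrow> real poly \<Rightarrow> real poly" where
  "deriv_numer_step N s p = [:real (N - s), - real (N + 3 * s + 2):] * p - [:0, 2, -2:] * pderiv p"

lemma deriv_numer_step_monom:
  "deriv_numer_step N s (monom 1 i) =
     smult (real (N - s) - 2 * real i) (monom 1 i)
     - smult (real (N + 3 * s + 2) - 2 * real i) (monom 1 (Suc i))"
  by (cases i) (rule poly_ext; simp add: deriv_numer_step_def pderiv_monom poly_monom algebra_simps)+

lemma deriv_numer_step_diff: "deriv_numer_step N s (p - q) = deriv_numer_step N s p - deriv_numer_step N s q"
proof -
  have "(a - b) - (c - d) = (a - c) - (b - d)" for a b c d :: "real poly"
    by (simp add: algebra_simps)
  then show ?thesis
    by (simp only: deriv_numer_step_def pderiv_diff right_diff_distrib)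
qed

lemma deriv_numer_step_smult: "deriv_numer_step N s (smult c p) = smult c (deriv_numer_step N s p)"
  by (simp only: deriv_numer_step_def pderiv_smult mult_smult_right smult_diff_right)

lemma deriv_numer_step_sum: "deriv_numer_step N s (sum f A) = (\<Sum>i\<in>A. deriv_numer_step N s (f i))"
proof -
  have "pderiv (sum f A) = (\<Sum>i\<in>A. pderiv (f i))"
    using higher_pderiv_sum[of 1 f A] by simp
  then show ?thesis
    by (simp only: deriv_numer_step_def sum_distrib_left sum_subtractf)
qed

text \<open>
  The multipliers \<open>N-s-2i\<close> and \<open>N+3s+2-2i\<close> of a monomial are exchanged, up to sign, by
  \<open>i \<mapsto> N+s+1-i\<close>. Hence the operator preserves antisymmetry while it raises the degree by one,
  and it suffices to follow the lower half of the coefficients.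
\<close>
lemma deriv_numer_step_antipal_binomial:
  assumes "s < N" "j \<le> s"
  shows "deriv_numer_step N s (antipal_binomial (N + s + 1) j) =
     smult (real (N - s) - 2 * real j) (antipal_binomial (N + Suc s + 1) j)
     - smult (real (N + 3 * s + 2) - 2 * real j) (antipal_binomial (N + Suc s + 1) (Suc j))"
proof -
  have 1: "N + Suc s + 1 - j = Suc (N + s + 1 - j)" "N + Suc s + 1 - Suc j = N + s + 1 - j"
    using assms by auto
  have 2: "real (N - s) - 2 * real (N + s + 1 - j) = - (real (N + 3 * s + 2) - 2 * real j)"
    "real (N + 3 * s + 2) - 2 * real (N + s + 1 - j) = - (real (N - s) - 2 * real j)"
    using assms by (auto simp: of_nat_diff)
  show ?thesis
    unfolding antipal_binomial_def deriv_numer_step_diff deriv_numer_step_monom 1 2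
    by (rule poly_ext) (simp add: algebra_simps)
qed

lemma deriv_numer_Suc:
  assumes "s < N"
  shows "deriv_numer_step N s (deriv_numer N s) = smult (real (N - s)) (deriv_numer N (Suc s))"
proof -
  let ?b = "antipal_binomial (N + Suc s + 1)" and ?a = "deriv_numer_coeff N s"
  let ?k = "\<lambda>j. real (N - s) - 2 * real j" and ?m = "\<lambda>j. real (N + 3 * s + 2) - 2 * real j"
  have "deriv_numer_step N s (deriv_numer N s) =
      (\<Sum>j\<le>s. smult (?k j * ?a j) (?b j)) - (\<Sum>j\<le>s. smult (?m j * ?a j) (?b (Suc j)))"
    unfolding deriv_numer_def deriv_numer_step_sum deriv_numer_step_smult atLeast0AtMost sum_subtractf[symmetric]
    using assms by (intro sum.cong refl, subst deriv_numer_step_antipal_binomial)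
      (simp_all add: smult_diff_right mult.commute)
  \<comment> \<open>The added term vanishes, as \<open>s choose Suc s = 0\<close>.\<close>
  also have "(\<Sum>j\<le>s. smult (?k j * ?a j) (?b j)) = (\<Sum>j\<le>Suc s. smult (?k j * ?a j) (?b j))"
    by (simp add: deriv_numer_coeff_def)
  also have "\<dots> = smult (?k 0 * ?a 0) (?b 0) + (\<Sum>j\<le>s. smult (?k (Suc j) * ?a (Suc j)) (?b (Suc j)))"
    by (rule sum.atMost_Suc_shift)
  also have "\<dots> - (\<Sum>j\<le>s. smult (?m j * ?a j) (?b (Suc j))) = smult (?k 0 * ?a 0) (?b 0) +
      (\<Sum>j\<le>s. smult (?k (Suc j) * ?a (Suc j) - ?m j * ?a j) (?b (Suc j)))"
    by (simp only: smult_diff_left sum_subtractf add_diff_eq)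
  also have "(\<Sum>j\<le>s. smult (?k (Suc j) * ?a (Suc j) - ?m j * ?a j) (?b (Suc j))) =
      (\<Sum>j\<le>s. smult (real (N - s) * deriv_numer_coeff N (Suc s) (Suc j)) (?b (Suc j)))"
    using assms by (intro sum.cong refl) (simp only: deriv_numer_coeff_Suc atMost_iff)
  also have "smult (?k 0 * ?a 0) (?b 0) = smult (real (N - s) * deriv_numer_coeff N (Suc s) 0) (?b 0)"
    by (simp add: deriv_numer_coeff_def)
  also have "\<dots> + (\<Sum>j\<le>s. smult (real (N - s) * deriv_numer_coeff N (Suc s) (Suc j)) (?b (Suc j))) =
      (\<Sum>j\<le>Suc s. smult (real (N - s) * deriv_numer_coeff N (Suc s) j) (?b j))"
    by (rule sum.atMost_Suc_shift[symmetric])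
  also have "\<dots> = smult (real (N - s)) (deriv_numer N (Suc s))"
    unfolding deriv_numer_def atLeast0AtMost
    by (rule poly_ext) (simp only: poly_sum poly_smult sum_distrib_left mult.assoc)
  finally show ?thesis .
qed

section \<open>Derivatives in the Joukowski coordinate\<close>

text \<open>This is \<open>U\<^sub>N(cos t) sin t = sin ((N+1)t)\<close> with \<open>w\<close> in place of \<open>exp(it)\<close>.\<close>
lemma cheb_U_joukowski:
  fixes w :: real
  assumes "w \<noteq> 0"
  shows "poly (cheb_U N) ((w + 1 / w) / 2) * w ^ N * (1 - w\<^sup>2) = 1 - w ^ (2 * N + 2)"
proof (induction N rule: induct_nat_012)
  case (ge2 n)
  have "poly (cheb_U (Suc (Suc n))) ((w + 1 / w) / 2) * w ^ Suc (Suc n) * (1 - w\<^sup>2) =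
     (w\<^sup>2 + 1) * (poly (cheb_U (Suc n)) ((w + 1 / w) / 2) * w ^ Suc n * (1 - w\<^sup>2)) 
      - w\<^sup>2 * (poly (cheb_U n) ((w + 1 / w) / 2) * w ^ n * (1 - w\<^sup>2))"
    using assms unfolding cheb_U_rec by (simp add: field_simps power2_eq_square)
  also have "\<dots> = 1 - w ^ (2 * Suc (Suc n) + 2)"
    unfolding ge2 by (simp add: algebra_simps power2_eq_square)
  finally show ?case .
qed (use assms in \<open>auto simp: cheb_U_0 cheb_U_1 field_simps power2_eq_square eval_nat_numeral\<close>)

text \<open>
  The induction step differentiates the identity for \<open>s\<close>, which holds near every \<open>w \<noteq> 0\<close>. After
  multiplication by \<open>-2w(1-w\<^sup>2)\<close>, the term with \<open>U\<^sub>N\<^sup>(\<^sup>s\<^sup>+\<^sup>1\<^sup>)\<close> is the left-hand side for \<open>s + 1\<close>; the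
  remaining terms contain \<open>U\<^sub>N\<^sup>(\<^sup>s\<^sup>)\<close>, which the identity for \<open>s\<close> turns back into \<open>P\<^sub>s\<close>, and \<open>P\<^sub>s'\<close>.
\<close>
lemma cheb_U_deriv_joukowski:
  fixes w :: real
  assumes "w \<noteq> 0" "s \<le> N"
  shows "poly (cheb_U_deriv s N) ((w + 1 / w) / 2) * w ^ (N - s) * (1 - w\<^sup>2) ^ (2 * s + 1) =
         2 ^ s * fact N / fact (N - s) * poly (deriv_numer N s) (w\<^sup>2)"
  using assms
proof (induction s arbitrary: w)
  case 0
  then show ?case
    using cheb_U_joukowski[of w N]
    by (simp add: cheb_U_deriv_def deriv_numer_def deriv_numer_coeff_def antipal_binomial_def poly_monom power_mult
        flip: power_Suc power_Suc2 power_mult)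
next
  case (Suc s)
  define k where "k = N - Suc s"
  have k: "N - s = Suc k" using Suc.prems by (simp add: k_def)
  define c :: real where "c = 2 ^ s * fact N / fact (Suc k)"
  define V where "V = cheb_U_deriv s N"
  define V' where "V' = cheb_U_deriv (Suc s) N"
  have V': "pderiv V = V'" by (simp add: V_def V'_def cheb_U_deriv_def)
  define P where "P = deriv_numer N s"
  define x where "x = (w + 1 / w) / 2"
  let ?f = "\<lambda>w. poly V ((w + 1 / w) / 2) * w ^ Suc k * (1 - w\<^sup>2) ^ (2 * s + 1)"
  let ?g = "\<lambda>w. c * poly P (w\<^sup>2)"
  have "((\<lambda>w. (w + 1 / w) / 2) has_real_derivative (1 - 1 / w\<^sup>2) / 2) (at w)"
    using Suc.prems by (auto intro!: derivative_eq_intros simp: power2_eq_square)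
  from DERIV_chain2[OF poly_DERIV this, of V]
  have D1: "((\<lambda>w. poly V ((w + 1 / w) / 2)) has_real_derivative
      poly V' x * ((1 - 1 / w\<^sup>2) / 2)) (at w)"
    by (simp only: V' x_def)
  have D2: "((\<lambda>w. w ^ Suc k) has_real_derivative real (Suc k) * w ^ k) (at w)"
    using DERIV_pow[of "Suc k" w] by simp
  have D3: "((\<lambda>w. (1 - w\<^sup>2) ^ (2 * s + 1)) has_real_derivative
      - (2 * w * real (2 * s + 1) * (1 - w\<^sup>2) ^ (2 * s))) (at w)"
    by (rule derivative_eq_intros refl)+ simp
  from DERIV_mult[OF DERIV_mult[OF D1 D2] D3]
  have "(?f has_real_derivative
      (poly V' x * ((1 - 1 / w\<^sup>2) / 2) * w ^ Suc k + real (Suc k) * w ^ k * poly V x)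
        * (1 - w\<^sup>2) ^ (2 * s + 1)
      - 2 * w * real (2 * s + 1) * (1 - w\<^sup>2) ^ (2 * s) * (poly V x * w ^ Suc k)) (at w)"
    by (simp add: x_def del: power_Suc)
  then have "(?g has_real_derivative
      (poly V' x * ((1 - 1 / w\<^sup>2) / 2) * w ^ Suc k + real (Suc k) * w ^ k * poly V x)
        * (1 - w\<^sup>2) ^ (2 * s + 1)
      - 2 * w * real (2 * s + 1) * (1 - w\<^sup>2) ^ (2 * s) * (poly V x * w ^ Suc k)) (at w)"
  proof (rule DERIV_cong_ev[THEN iffD1, rotated 3])
    have "eventually (\<lambda>w. w \<noteq> 0) (nhds w)"
      using Suc.prems by (intro t1_space_nhds) auto
    then show "eventually (\<lambda>w. ?f w = ?g w) (nhds w)"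
      by eventually_elim (use Suc.IH Suc.prems k in \<open>simp add: V_def P_def c_def\<close>)
  qed simp_all
  moreover have "(?g has_real_derivative c * (2 * w * poly (pderiv P) (w\<^sup>2))) (at w)"
    by (auto intro!: derivative_eq_intros DERIV_chain'[OF _ poly_DERIV])
  ultimately have E: "(poly V' x * ((1 - 1 / w\<^sup>2) / 2) * w ^ Suc k + real (Suc k) * w ^ k * poly V x)
        * (1 - w\<^sup>2) ^ (2 * s + 1)
      - 2 * w * real (2 * s + 1) * (1 - w\<^sup>2) ^ (2 * s) * (poly V x * w ^ Suc k)
      = c * (2 * w * poly (pderiv P) (w\<^sup>2))"
    by (rule DERIV_unique)
  have F: "poly V x * w ^ Suc k * (1 - w\<^sup>2) ^ (2 * s + 1) = c * poly P (w\<^sup>2)"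
    using Suc.IH[of w] Suc.prems k by (simp add: V_def P_def c_def x_def)
  have R: "real (Suc k) * poly (deriv_numer N (Suc s)) (w\<^sup>2) =
      (real (Suc k) - real (N + 3 * s + 2) * w\<^sup>2) * poly P (w\<^sup>2)
      - 2 * w\<^sup>2 * (1 - w\<^sup>2) * poly (pderiv P) (w\<^sup>2)"
    using arg_cong[OF deriv_numer_Suc[of s N], of "\<lambda>p. poly p (w\<^sup>2)"] Suc.prems k
    by (simp add: deriv_numer_step_def P_def algebra_simps)
  \<comment> \<open>The factor \<open>-2w(1 - w\<^sup>2)\<close> turns \<open>dx/dw = (1 - 1/w\<^sup>2)/2\<close> into \<open>(1 - w\<^sup>2)\<^sup>2/w\<close>.\<close>
  have "poly V' x * w ^ k * (1 - w\<^sup>2) ^ (2 * Suc s + 1) =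
     - 2 * w * (1 - w\<^sup>2) *
       (poly V' x * ((1 - 1 / w\<^sup>2) / 2) * w ^ Suc k * (1 - w\<^sup>2) ^ (2 * s + 1))"
    using Suc.prems by (simp add: field_simps power2_eq_square)
  also have "\<dots> = - 2 * w * (1 - w\<^sup>2) * (c * (2 * w * poly (pderiv P) (w\<^sup>2)))
     + 2 * (real (Suc k) * (1 - w\<^sup>2) - 2 * w\<^sup>2 * real (2 * s + 1)) *
         (poly V x * w ^ Suc k * (1 - w\<^sup>2) ^ (2 * s + 1))"
    unfolding E[symmetric] by (simp add: algebra_simps power2_eq_square)
  also have "\<dots> = 2 * c * (real (Suc k) * poly (deriv_numer N (Suc s)) (w\<^sup>2))"
  proof -
    have "real N = real k + real s + 1" using k Suc.prems by linarith
    then show ?thesis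
      unfolding F R by (simp add: algebra_simps power2_eq_square eval_nat_numeral)
  qed
  also have "\<dots> = 2 ^ Suc s * fact N / fact k * poly (deriv_numer N (Suc s)) (w\<^sup>2)"
    by (simp add: c_def divide_simps del: of_nat_Suc)
  finally show ?case
    by (simp only: V'_def x_def k_def)
qed

section \<open>All zeros are real and simple\<close>

lemma cheb_U_cos: "poly (cheb_U N) (cos t) * sin t = sin (real (Suc N) * t)"
proof (induction N rule: induct_nat_012)
  case 1
  then show ?case by (simp add: cheb_U_1 sin_double)
next
  case (ge2 n)
  have a: "real (Suc (Suc (Suc n))) * t = real (Suc (Suc n)) * t + t"
    "real (Suc n) * t = real (Suc (Suc n)) * t - t"
    by (auto simp: algebra_simps)
  have "poly (cheb_U (Suc (Suc n))) (cos t) * sin t =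
    2 * cos t * sin (real (Suc (Suc n)) * t) - sin (real (Suc n) * t)"
    unfolding cheb_U_rec ge2[symmetric] by (simp add: algebra_simps)
  also have "\<dots> = sin (real (Suc (Suc (Suc n))) * t)"
    unfolding a sin_add sin_diff by simp
  finally show ?case .
qed (simp add: cheb_U_0)

lemma cheb_U_nonzero: "cheb_U N \<noteq> 0"
proof -
  have "sin (real (Suc N) * (pi / (2 * real (Suc N)))) = 1"
    by (simp del: of_nat_Suc)
  then show ?thesis using cheb_U_cos[of N "pi / (2 * real (Suc N))"] by auto
qed

lemma degree_cheb_U: "degree (cheb_U N) = N"
proof (induction N rule: induct_nat_012)
  case (ge2 n)
  have "degree ([:0, 2:] * cheb_U (Suc n)) = Suc (Suc n)"
    using cheb_U_nonzero[of "Suc n"] ge2 by (subst degree_mult_eq) auto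
  with ge2 show ?case
    unfolding cheb_U_rec diff_conv_add_uminus by (subst degree_add_eq_left) auto
qed (simp_all add: cheb_U_0 cheb_U_1)

text \<open>
  Rolle's theorem provides a zero of the derivative between each zero of \<open>p\<close> and the next one.
  These zeros are distinct and there are \<open>degree p - 1\<close> of them, which is all the degree of the
  derivative permits.
\<close>
lemma card_roots_pderiv:
  fixes p :: "real poly"
  assumes "card {x. poly p x = 0} = degree p"
  shows "card {x. poly (pderiv p) x = 0} = degree (pderiv p)"
proof (cases "degree p = 0")
  \<comment> \<open>The derivative is 0; its set of zeros is infinite and therefore has \<open>card\<close> 0.\<close>
  case True
  then have "pderiv p = 0" by (simp add: pderiv_eq_0_iff)
  then show ?thesis by (simp add: infinite_UNIV_char_0)
next
  case False
  define S where "S = {x. poly p x = 0}"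
  have "p \<noteq> 0" using False by auto
  then have fin: "finite S" by (simp add: S_def poly_roots_finite)
  have "S \<noteq> {}" using assms False unfolding S_def by (metis card.empty)
  have "\<exists>y>a. poly (pderiv p) y = 0 \<and> (\<forall>b\<in>S. a < b \<longrightarrow> y < b)" if "a \<in> S - {Max S}" for a
  proof -
    define b where "b = Min {x\<in>S. a < x}"
    have "Max S \<in> {x\<in>S. a < x}"
      using that fin \<open>S \<noteq> {}\<close> by (auto simp: order_less_le)
    then have ne: "{x\<in>S. a < x} \<noteq> {}" "finite {x\<in>S. a < x}" using fin by auto
    have b: "b \<in> S" "a < b" using Min_in[OF ne(2,1)] by (auto simp: b_def)
    obtain y where y: "a < y" "y < b" "poly p b - poly p a = (b - a) * poly (pderiv p) y"
      using poly_MVT[OF b(2)] by blast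
    have "poly (pderiv p) y = 0" using y b that by (auto simp: S_def)
    moreover have "y < c" if "c \<in> S" "a < c" for c
      using y(2) Min_le[OF ne(2), of c] that by (auto simp: b_def)
    ultimately show ?thesis using y by blast
  qed
  \<comment> \<open>As \<open>f a\<close> lies below all later zeros of \<open>p\<close>, the map \<open>f\<close> is strictly increasing.\<close>
  then obtain f where f: "\<And>a. a \<in> S - {Max S} \<Longrightarrow>
      f a > a \<and> poly (pderiv p) (f a) = 0 \<and> (\<forall>b\<in>S. a < b \<longrightarrow> f a < b)"
    by metis
  have "inj_on f (S - {Max S})"
    by (rule inj_onI) (smt (verit, best) f DiffD1)
  have nz: "pderiv p \<noteq> 0" using False by (simp add: pderiv_eq_0_iff)
  have "degree (pderiv p) = card (S - {Max S})"
    using assms fin \<open>S \<noteq> {}\<close> by (simp add: degree_pderiv flip: S_def)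
  also have "\<dots> = card (f ` (S - {Max S}))"
    using \<open>inj_on f _\<close> by (simp add: card_image)
  also have "\<dots> \<le> card {x. poly (pderiv p) x = 0}"
    using f nz by (intro card_mono poly_roots_finite) auto
  finally show ?thesis
    using card_poly_roots_bound[OF nz] by simp
qed

lemma cheb_U_card_roots: "card {x. poly (cheb_U N) x = 0} = N"
proof (rule antisym)
  have nz: "cheb_U N \<noteq> 0" by (rule cheb_U_nonzero)
  show "card {x. poly (cheb_U N) x = 0} \<le> N"
    using card_poly_roots_bound[OF nz] by (simp add: degree_cheb_U)
  define f where "f = (\<lambda>k::nat. cos (real k * pi / real (Suc N)))"
  have range: "0 < real k * pi / real (Suc N)" "real k * pi / real (Suc N) < pi"
    if "k \<in> {1..N}" for k
  proof -
    show "0 < real k * pi / real (Suc N)" using that by simp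
    have "real k * pi < real (Suc N) * pi"
      using that by (intro mult_strict_right_mono) auto
    then show "real k * pi / real (Suc N) < pi"
      by (simp only: pos_divide_less_eq of_nat_0_less_iff zero_less_Suc mult.commute)
  qed
  have "inj_on f {1..N}"
  proof (rule inj_onI)
    fix k l assume kl: "k \<in> {1..N}" "l \<in> {1..N}" "f k = f l"
    have "real k * pi / real (Suc N) = real l * pi / real (Suc N)"
    proof (rule cos_inj_pi)
      show "cos (real k * pi / real (Suc N)) = cos (real l * pi / real (Suc N))"
        using kl(3) by (simp only: f_def)
    qed (use range[OF kl(1)] range[OF kl(2)] in \<open>simp_all only: less_imp_le\<close>)
    then show "k = l" by (simp add: divide_simps del: of_nat_Suc)
  qed
  then have "N = card (f ` {1..N})" by (simp add: card_image)
  also have "\<dots> \<le> card {x. poly (cheb_U N) x = 0}"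
  proof (intro card_mono poly_roots_finite nz subsetI)
    fix x assume "x \<in> f ` {1..N}"
    then obtain k where k: "k \<in> {1..N}" "x = f k" by blast
    have "sin (real (Suc N) * (real k * pi / real (Suc N))) = 0"
      by (simp add: sin_npi del: of_nat_Suc)
    with cheb_U_cos[of N "real k * pi / real (Suc N)"] sin_gt_zero[OF range[OF k(1)]]
    show "x \<in> {x. poly (cheb_U N) x = 0}"
      by (simp add: k f_def del: of_nat_Suc)
  qed
  finally show "N \<le> card {x. poly (cheb_U N) x = 0}" .
qed

lemma degree_cheb_U_deriv: "degree (cheb_U_deriv s N) = N - s"
  by (induction s) (simp_all add: cheb_U_deriv_Suc degree_pderiv degree_cheb_U,
     simp add: cheb_U_deriv_def degree_cheb_U)

lemma cheb_U_deriv_nonzero: "s \<le> N \<Longrightarrow> cheb_U_deriv s N \<noteq> 0"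
proof (induction s)
  case 0
  show ?case by (simp add: cheb_U_deriv_def cheb_U_nonzero)
qed (simp add: cheb_U_deriv_Suc pderiv_eq_0_iff degree_cheb_U_deriv)

lemma card_roots_cheb_U_deriv:
  "card {x. poly (cheb_U_deriv s N) x = 0} = degree (cheb_U_deriv s N)"
proof (induction s)
  case 0
  then show ?case by (simp add: cheb_U_deriv_def cheb_U_card_roots degree_cheb_U)
qed (simp add: cheb_U_deriv_Suc card_roots_pderiv)

section \<open>Parity and factorization\<close>

lemma cheb_U_minus: "poly (cheb_U N) (-x) = (-1) ^ N * poly (cheb_U N) x"
  by (induction N rule: induct_nat_012) (auto simp: cheb_U_0 cheb_U_1 cheb_U_rec algebra_simps)

lemma cheb_U_deriv_minus:
  "s \<le> N \<Longrightarrow> poly (cheb_U_deriv s N) (-x) = (-1) ^ (N - s) * poly (cheb_U_deriv s N) x"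
proof (induction s arbitrary: x)
  case 0
  then show ?case by (simp add: cheb_U_deriv_def cheb_U_minus)
next
  case (Suc s)
  let ?p = "cheb_U_deriv s N"
  have "pcompose ?p [:0, -1:] = smult ((-1) ^ (N - s)) ?p"
    using Suc by (intro poly_ext) (simp add: poly_pcompose)
  from arg_cong[OF this, of "\<lambda>q. poly (pderiv q) x"]
  have "- poly (pderiv ?p) (-x) = (-1) ^ (N - s) * poly (pderiv ?p) x"
    by (simp add: pderiv_pcompose pderiv_smult poly_pcompose pderiv_pCons)
  moreover have "N - s = Suc (N - Suc s)" using Suc by simp
  ultimately show ?case by (simp add: cheb_U_deriv_Suc)
qed

text \<open>
  By symmetry the negative zeros are the negatives of the positive ones, so counting gives
  \<open>degree p = 2 card S\<close>, plus 1 if 0 is a zero; the parity of the degree decides which.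
  The product then has the degree, the leading coefficient (after scaling) and the zeros of \<open>p\<close>,
  and is determined by these data.
\<close>
lemma symmetric_poly_factorization:
  fixes p :: "real poly"
  assumes card: "card {x. poly p x = 0} = degree p"
    and sym: "\<And>x. poly p (-x) = (-1) ^ degree p * poly p x"
    and nz: "p \<noteq> 0"
  defines "S \<equiv> {x. 0 < x \<and> poly p x = 0}"
  shows "degree p = degree p mod 2 + 2 * card S"
    "p = smult (lead_coeff p) ([:0, 1:] ^ (degree p mod 2) * (\<Prod>\<nu>\<in>S. [:- \<nu>\<^sup>2, 0, 1:]))"
proof -
  define Z where "Z = {x. x = 0 \<and> poly p x = 0}"
  have fin: "finite {x. poly p x = 0}" using nz by (rule poly_roots_finite)
  then have finS: "finite S" by (simp add: S_def)
  have sym0: "poly p (-x) = 0 \<longleftrightarrow> poly p x = 0" for x by (simp add: sym)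
  have neg: "{x. x < 0 \<and> poly p x = 0} = uminus ` S"
  proof (intro equalityI subsetI)
    fix x assume "x \<in> {x. x < 0 \<and> poly p x = 0}"
    then have "-x \<in> S" by (simp add: S_def sym0)
    then show "x \<in> uminus ` S" by force
  qed (auto simp: S_def sym0)
  have roots: "{x. poly p x = 0} = Z \<union> (S \<union> uminus ` S)"
    unfolding neg[symmetric] by (auto simp: S_def Z_def)
  have finZ: "finite Z" by (rule finite_subset[of _ "{0}"]) (auto simp: Z_def)
  have "card {x. poly p x = 0} = card Z + (card S + card (uminus ` S))"
    unfolding roots using finS finZ
    by (subst card_Un_disjoint | force simp: S_def Z_def)+
  also have "card (uminus ` S) = card S" by (simp add: card_image)
  finally have deg: "degree p = card Z + 2 * card S" using card by simp
  have "card Z \<le> card {0::real}" by (rule card_mono) (auto simp: Z_def)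
  then have "card Z \<le> 1" by simp
  then have Z: "card Z = degree p mod 2" using deg by presburger
  then show deg': "degree p = degree p mod 2 + 2 * card S" using deg by simp
  define q where "q = [:0, 1:] ^ (degree p mod 2) * (\<Prod>\<nu>\<in>S. [:- \<nu>\<^sup>2, 0, 1:])"
  have "lead_coeff q = 1"
    by (simp add: q_def lead_coeff_mult lead_coeff_power lead_coeff_prod)
  have "degree q = degree p mod 2 + 2 * card S"
    unfolding q_def by (subst degree_mult_eq)
      (simp_all add: degree_power_eq degree_prod_eq_sum_degree finS)
  then have dq: "degree q = degree p" using deg' by simp
  have "poly q x = 0" if x: "poly p x = 0" for x
  proof (cases "x = 0")
    case True
    with x have "Z = {0}" by (auto simp: Z_def)
    then show ?thesis using Z True by (simp add: q_def)
  next
    case False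
    then have "\<bar>x\<bar> \<in> S" using x by (auto simp: S_def abs_if sym0)
    then have "\<exists>\<nu>\<in>S. poly [:- \<nu>\<^sup>2, 0, 1:] x = 0" by (intro bexI[of _ "\<bar>x\<bar>"]) (auto simp: power2_eq_square)
    then show ?thesis using finS by (auto simp: q_def poly_prod)
  qed
  then show "p = smult (lead_coeff p) q"
    using \<open>lead_coeff q = 1\<close> dq nz card
    by (intro poly_eqI_degree_lead_coeff[where A = "{x. poly p x = 0}" and n = "degree p"]) auto
qed

section \<open>Comparison of the two expressions\<close>

theorem corollary3p3:
  fixes N s :: nat
  assumes "s \<le> N"
  shows "(\<Sum>j = 0..s.
            smult ((-1) ^ j * real (s choose j) * real ((N + s + 1) choose j)
                     * inverse (real (N choose j)))
              (monom 1 j - monom 1 (N + s + 1 - j)))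
         = [:1, -1:] ^ (2 * s + 1) * (if odd (N - s) then [:1, 1:] else 1)
             * (\<Prod>\<nu>\<in>pos_zeros_U s N. [:1, 2 * (1 - 2 * \<nu>\<^sup>2), 1:])"
proof -
  define V where "V = cheb_U_deriv s N"
  define S where "S = pos_zeros_U s N"
  define e where "e = (N - s) mod 2"
  define R where "R = [:1, -1:] ^ (2 * s + 1) * [:1, 1:] ^ e * (\<Prod>\<nu>\<in>S. [:1, 2 * (1 - 2 * \<nu>\<^sup>2), 1:])"
  define c :: real where "c = 2 ^ s * fact N / fact (N - s)"
  define d where "d = lead_coeff V / 2 ^ (N - s)"
  have deg: "degree V = N - s" by (simp add: V_def degree_cheb_U_deriv)
  have nz: "V \<noteq> 0" using assms by (simp add: V_def cheb_U_deriv_nonzero)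
  have V: "e + 2 * card S = N - s"
    "V = smult (lead_coeff V) ([:0, 1:] ^ e * (\<Prod>\<nu>\<in>S. [:- \<nu>\<^sup>2, 0, 1:]))"
    using symmetric_poly_factorization[of V] nz card_roots_cheb_U_deriv[of s N] assms cheb_U_deriv_minus[of s N]
    by (simp_all add: deg V_def[symmetric] e_def S_def pos_zeros_U_def)
  \<comment> \<open>Each of the \<open>e + 2 card S = N - s\<close> powers of \<open>w\<close> is absorbed by one linear factor of \<open>V\<close>.\<close>
  have eq: "poly (smult c (deriv_numer N s)) z = poly (smult d R) z" if "z > 0" for z
  proof -
    define w where "w = sqrt z"
    have w: "w > 0" "w\<^sup>2 = z" using that by (auto simp: w_def)
    let ?x = "(w + 1 / w) / 2"
    have lin: "?x * w = (1 + z) / 2" using w by (simp add: field_simps power2_eq_square)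
    have quad: "(?x\<^sup>2 - \<nu>\<^sup>2) * w\<^sup>2 = poly [:1, 2 * (1 - 2 * \<nu>\<^sup>2), 1:] z / 4" for \<nu>
      using w(1) unfolding w(2)[symmetric] by (simp add: field_simps power2_eq_square)
    have "poly V ?x * w ^ (N - s) = lead_coeff V * (?x * w) ^ e * (\<Prod>\<nu>\<in>S. (?x\<^sup>2 - \<nu>\<^sup>2) * w\<^sup>2)"
      unfolding V(1)[symmetric]
      by (subst V(2)) (simp add: poly_prod power_add power_mult prod.distrib power_mult_distrib
          power2_eq_square del: times_divide_eq_left)
    also have "\<dots> = lead_coeff V * ((1 + z) / 2) ^ e *
        (\<Prod>\<nu>\<in>S. poly [:1, 2 * (1 - 2 * \<nu>\<^sup>2), 1:] z / 4)"
      by (simp only: lin quad)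
    also have "\<dots> = d * ((1 + z) ^ e * (\<Prod>\<nu>\<in>S. poly [:1, 2 * (1 - 2 * \<nu>\<^sup>2), 1:] z))"
      unfolding d_def V(1)[symmetric]
      by (simp add: prod_dividef power_divide power_add power_mult)
    finally have 1: "poly V ?x * w ^ (N - s) = \<dots>" .
    have "poly V ?x * w ^ (N - s) * (1 - w\<^sup>2) ^ (2 * s + 1) = c * poly (deriv_numer N s) (w\<^sup>2)"
      using cheb_U_deriv_joukowski[of w s N] w assms by (simp add: V_def c_def)
    then show ?thesis
      unfolding 1 w(2) R_def by (simp add: poly_prod ac_simps del: power_Suc mult_pCons_left)
  qed
  have "smult c (deriv_numer N s) = smult d R"
  proof (rule ccontr)
    assume "smult c (deriv_numer N s) \<noteq> smult d R"
    then have "finite {z. poly (smult c (deriv_numer N s) - smult d R) z = 0}"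
      by (intro poly_roots_finite) simp
    moreover have "{0<..} \<subseteq> {z. poly (smult c (deriv_numer N s) - smult d R) z = 0}"
      using eq by auto
    ultimately show False using finite_subset infinite_Ioi by blast
  qed
  \<comment> \<open>Comparing constant terms shows that the two constants of proportionality agree.\<close>
  moreover have "poly (deriv_numer N s) 0 = 1"
  proof -
    have "poly (deriv_numer N s) 0 = (\<Sum>j = 0..s. if j = 0 then 1 else 0)"
      unfolding deriv_numer_def poly_sum using assms
      by (intro sum.cong refl) (auto simp: deriv_numer_coeff_def antipal_binomial_def poly_monom power_0_left)
    then show ?thesis by simp
  qed
  moreover have "poly R 0 = 1" by (simp add: R_def poly_prod)
  ultimately have "c = d"
    by (metis mult.right_neutral poly_smult)
  moreover have "c \<noteq> 0" by (simp add: c_def)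
  ultimately have "deriv_numer N s = R" using \<open>smult c (deriv_numer N s) = smult d R\<close> by (metis smult_cancel)
  moreover have "[:1, 1:] ^ e = (if odd (N - s) then [:1, 1:] else (1 :: real poly))"
    by (simp add: e_def odd_iff_mod_2_eq_one even_iff_mod_2_eq_zero)
  ultimately show ?thesis
    unfolding deriv_numer_def deriv_numer_coeff_def antipal_binomial_def R_def S_def by simp
qed

end
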